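(* Let $\mathcal{L}\subset\operatorname{Lip}_1(\mathbb{R})$ be a monoidal subfamily with $\mathcal{L}\supset\mathcal{T}$ and let $X$ be a geometric data set. Then any $\mathcal{L}$-closed subfamily $F\subset F_X$ is $\mathcal{L}$-compact.
   Context: A geometric data set is a triple $X=(X,F_X,\mu_X)$ where $F_X$ is a nonempty set of real-valued functions on $X$ such that $d_X(x,y):=\sup_{f\in F_X}|f(x)-f(y)|$ is a complete separable metric on $X$, and $\mu_X$ is a Borel probability measure with full support on $(X,d_X)$. $d_{\mathrm{KF}}^X(f,g):=\inf\{\epsilon\ge 0: \mu_X(\{|f-g|>\epsilon\})\le\epsilon\}$ is the Ky Fan metric; $U(A,\epsilon;d)$ is the open $\epsilon$-neighborhood of $A$. $\operatorname{Lip}_1(\mathbb{R})$ is the set of 1-Lipschitz functions $\mathbb{R}\to\mathbb{R}$. $\mathcal{L}\subset\operatorname{Lip}_1(\mathbb{R})$ is monoidal if it contains $\mathrm{id}_{\mathbb{R}}$, is closed under composition, and is closed under pointwise convergence on $\mathbb{R}$. $\mathcal{T}:=\{x\mapsto x+c: c\in\mathbb{R}\}$. $\mathcal{L}\circ F:=\{p\circ f: p\in\mathcal{L}, f\in F\}$. A subfamily $F$ is $\mathcal{L}$-closed if $\mathcal{L}\circ F\subset F$; it is $\mathcal{L}$-compact if it is $\mathcal{L}$-closed and, for every $\epsilon>0$, $\operatorname{Cov}(F,\epsilon;\mathcal{L}):=\inf\{\#\mathcal{N}: \mathcal{N}\subset F\text{ finite}, F\subset U(\mathcal{L}\circ\mathcal{N},\epsilon;d_{\mathrm{KF}}^X)\}$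 is finite. *)

theory Defs
  imports "HOL-Analysis.Analysis" "HOL-Probability.Probability_Measure"
begin

text \<open>
  Real-valued functions on a set \<open>X\<close> are represented by the elements of \<open>X \<rightarrow>\<^sub>E UNIV\<close>, so that
  equality in HOL is equality of functions on \<open>X\<close>. Composition with a function on the reals is
  accordingly \<open>compose X p f\<close>.
\<close>

text \<open>
  The value off \<open>X\<close> is irrelevant; 0 is chosen because \<open>Metric_space\<close> demands
  nonnegativity and symmetry on the whole type.
\<close>
definition data_dist :: "'a set \<Rightarrow> ('a \<Rightarrow> real) set \<Rightarrow> 'a \<Rightarrow> 'a \<Rightarrow> real" where
  "data_dist X FX x y = (if x \<in> X \<and> y \<in> X then (SUP f\<in>FX. \<bar>f x - f y\<bar>) else 0)"

text \<open>
  The real-valued supremum is meaningful only for bounded sets; boundedness is the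
  finiteness of \<open>d\<^sub>X\<close>, which is part of its being a metric.
\<close>
locale geometric_data_set =
  fixes X :: "'a set" and FX :: "('a \<Rightarrow> real) set" and \<mu> :: "'a measure"
  assumes features_nonempty: "FX \<noteq> {}"
    and features_funcset: "FX \<subseteq> X \<rightarrow>\<^sub>E UNIV"
    and dist_finite: "\<And>x y. x \<in> X \<Longrightarrow> y \<in> X \<Longrightarrow> bdd_above ((\<lambda>f. \<bar>f x - f y\<bar>) ` FX)"
    and metric: "Metric_space X (data_dist X FX)"
    and complete: "Metric_space.mcomplete X (data_dist X FX)"
    and separable: "separable_space (Metric_space.mtopology X (data_dist X FX))"
    and space_eq: "space \<mu> = X"
    and borel_sets: "sets \<mu> = sigma_sets X {U. openin (Metric_space.mtopology X (data_dist X FX)) U}"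
    and prob: "prob_space \<mu>"
    and full_support:
      "\<And>U. openin (Metric_space.mtopology X (data_dist X FX)) U \<Longrightarrow> U \<noteq> {} \<Longrightarrow> 0 < measure \<mu> U"

definition ky_fan :: "'a measure \<Rightarrow> ('a \<Rightarrow> real) \<Rightarrow> ('a \<Rightarrow> real) \<Rightarrow> real" where
  "ky_fan \<mu> f g = Inf {\<epsilon>. 0 \<le> \<epsilon> \<and> measure \<mu> {x \<in> space \<mu>. \<epsilon> < \<bar>f x - g x\<bar>} \<le> \<epsilon>}"

definition open_nbhd :: "'b set \<Rightarrow> real \<Rightarrow> ('b \<Rightarrow> 'b \<Rightarrow> real) \<Rightarrow> 'b set" where
  "open_nbhd A \<epsilon> d = {b. \<exists>a\<in>A. d a b < \<epsilon>}"

definition Lip1_real :: "(real \<Rightarrow> real) set" where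
  "Lip1_real = {p. 1-lipschitz_on UNIV p}"

definition real_translations :: "(real \<Rightarrow> real) set" where
  "real_translations = {(\<lambda>x. x + c) | c. True}"

text \<open>
  Sequences suffice for closedness: pointwise convergence is metrizable on \<open>Lip1_real\<close>.
\<close>
definition monoidal :: "(real \<Rightarrow> real) set \<Rightarrow> bool" where
  "monoidal L \<longleftrightarrow> L \<subseteq> Lip1_real \<and> id \<in> L \<and> (\<forall>p\<in>L. \<forall>q\<in>L. p \<circ> q \<in> L) \<and>
     (\<forall>p q. (\<forall>n. p n \<in> L) \<longrightarrow> (\<forall>x. (\<lambda>n::nat. p n x) \<longlonglongrightarrow> q x) \<longrightarrow> q \<in> L)"

definition comp_family :: "'a set \<Rightarrow> (real \<Rightarrow> real) set \<Rightarrow> ('a \<Rightarrow> real) set \<Rightarrow> ('a \<Rightarrow> real) set" where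
  "comp_family X L F = {compose X p f | p f. p \<in> L \<and> f \<in> F}"

definition L_closed :: "'a set \<Rightarrow> (real \<Rightarrow> real) set \<Rightarrow> ('a \<Rightarrow> real) set \<Rightarrow> bool" where
  "L_closed X L F \<longleftrightarrow> comp_family X L F \<subseteq> F"

text \<open>The infimum is taken in \<open>enat\<close>, where the infimum of the empty set is \<open>\<infinity>\<close>.\<close>
definition covering_number ::
  "'a set \<Rightarrow> 'a measure \<Rightarrow> (real \<Rightarrow> real) set \<Rightarrow> ('a \<Rightarrow> real) set \<Rightarrow> real \<Rightarrow> enat" where
  "covering_number X \<mu> L F \<epsilon> =
     Inf {enat (card N) | N. finite N \<and> N \<subseteq> F \<and> F \<subseteq> open_nbhd (comp_family X L N) \<epsilon> (ky_fan \<mu>)}"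

definition L_compact ::
  "'a set \<Rightarrow> 'a measure \<Rightarrow> (real \<Rightarrow> real) set \<Rightarrow> ('a \<Rightarrow> real) set \<Rightarrow> bool" where
  "L_compact X \<mu> L F \<longleftrightarrow> L_closed X L F \<and> (\<forall>\<epsilon>>0. covering_number X \<mu> L F \<epsilon> < \<infinity>)"

end

theory Submission
  imports Defs
begin

text \<open>
  Up to measure \<open>\<epsilon>/2\<close> the space is covered by finitely many balls of radius \<open>\<epsilon>/6\<close>, with centres
  \<open>C\<close>. After a translation making all features vanish at a base point, the values of a feature at
  the centres are bounded independently of the feature, so rounding them to multiples of
  \<open>\<epsilon>/6\<close> leaves only finitely many value patterns. Two features with the same pattern differ, up to
  a translation, by at most \<open>\<epsilon>/6\<close> at the centres, hence by at most \<open>\<epsilon>/2\<close> on the balls because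
  features are 1-Lipschitz. One representative per pattern therefore gives the covering.
\<close>

text \<open>Features are 1-Lipschitz because the distance is a supremum over them;
  \<open>dist_finite\<close> makes that real supremum a genuine upper bound.\<close>

lemma (in geometric_data_set) abs_feature_diff_le:
  assumes "f \<in> FX" "x \<in> X" "y \<in> X"
  shows "\<bar>f x - f y\<bar> \<le> data_dist X FX x y"
  unfolding data_dist_def using assms cSUP_upper[OF assms(1) dist_finite[OF assms(2,3)]] by simp

text \<open>The balls around a dense sequence cover \<open>X\<close>, so the complements of their
  finite unions decrease to the empty set, and continuity from above sends their measures to
  0.\<close>

lemma (in geometric_data_set) finite_ball_cover:
  assumes "r > 0" "\<delta> > 0"
  obtains C where "finite C" "C \<subseteq> X"
    "(\<Union>c\<in>C. Metric_space.mball X (data_dist X FX) c r) \<in> sets \<mu>"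
    "measure \<mu> (X - (\<Union>c\<in>C. Metric_space.mball X (data_dist X FX) c r)) < \<delta>"
proof -
  interpret M: Metric_space X "data_dist X FX" by (rule metric)
  interpret P: prob_space \<mu> by (rule prob)
  obtain D where D: "countable D" "D \<subseteq> X" "M.mtopology closure_of D = X"
    using separable unfolding separable_space_def by auto
  have "X \<noteq> {}" using P.not_empty space_eq by simp
  then have "D \<noteq> {}" using D by auto
  \<comment> \<open>Repetitions are harmless, so a finite \<open>D\<close> needs no separate
    treatment.\<close>
  define e where "e = from_nat_into D"
  have eX: "e n \<in> X" for n
    using from_nat_into[OF \<open>D \<noteq> {}\<close>] D(2) unfolding e_def by blast
  have ball_sets: "M.mball c r \<in> sets \<mu>" for c
    unfolding borel_sets by (rule sigma_sets.Basic) simp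
  define A where "A n = X - (\<Union>i<n. M.mball (e i) r)" for n
  have A_sets: "range A \<subseteq> sets \<mu>"
    unfolding A_def using ball_sets space_eq[symmetric] by auto
  have "decseq A" unfolding A_def decseq_def by fastforce
  have "(\<Inter>n. A n) = {}"
  proof (rule ccontr)
    assume "(\<Inter>n. A n) \<noteq> {}"
    then obtain x where xA: "\<And>n. x \<in> A n" by blast
    then have x: "x \<in> X" "\<And>i. x \<notin> M.mball (e i) r"
      unfolding A_def by (blast, blast)
    \<comment> \<open>Density puts a point of \<open>D\<close> within \<open>r\<close> of
      \<open>x\<close>; by symmetry \<open>x\<close> then lies in one of the removed balls.\<close>
    have "x \<in> M.mtopology closure_of D" using x(1) D(3) by simp
    then obtain d where d: "d \<in> D" "d \<in> M.mball x r"
      unfolding M.metric_closure_of using assms(1) by blast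
    then obtain i where "e i = d"
      unfolding e_def using from_nat_into_surj[OF D(1)] by blast
    then show False using x(2)[of i] d(2) by (auto simp: M.commute)
  qed
  then have "(\<lambda>n. measure \<mu> (A n)) \<longlonglongrightarrow> 0"
    using P.finite_Lim_measure_decseq[OF A_sets \<open>decseq A\<close>] by simp
  then obtain n where n: "measure \<mu> (A n) < \<delta>"
    using order_tendstoD(2)[OF _ assms(2)] eventually_happens'[OF sequentially_bot] by blast
  show thesis
  proof (rule that[of "e ` {..<n}"])
    show "(\<Union>c\<in>e ` {..<n}. M.mball c r) \<in> sets \<mu>" using ball_sets by blast
    show "measure \<mu> (X - (\<Union>c\<in>e ` {..<n}. M.mball c r)) < \<delta>"
      using n unfolding A_def by simp
  qed (use eX in auto)
qed

text \<open>The bounds place \<epsilon> itself in the set whose infimum is \<open>ky_fan\<close>.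
  Monotonicity of the measure asks only that the larger set, the complement of \<open>B\<close>, be
  measurable.\<close>

lemma ky_fan_le:
  assumes "finite_measure \<mu>" "B \<in> sets \<mu>" "measure \<mu> (space \<mu> - B) \<le> \<epsilon>"
    and "\<And>x. x \<in> B \<Longrightarrow> \<bar>f x - g x\<bar> \<le> \<epsilon>"
  shows "ky_fan \<mu> f g \<le> \<epsilon>"
proof -
  interpret finite_measure \<mu> by fact
  have "measure \<mu> {x \<in> space \<mu>. \<epsilon> < \<bar>f x - g x\<bar>} \<le> measure \<mu> (space \<mu> - B)"
    by (rule finite_measure_mono) (use assms(2,4) in \<open>auto simp: not_less[symmetric]\<close>)
  moreover have "0 \<le> \<epsilon>" using assms(3) measure_nonneg order_trans by blast
  ultimately show ?thesis
    unfolding ky_fan_def using assms(3) by (intro cInf_lower bdd_belowI[of _ 0]) auto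
qed

text \<open>The patterns lie in a finite product of integer intervals; restriction to
  \<open>C\<close> fixes their values elsewhere.\<close>

lemma finite_floor_patterns:
  fixes u :: "'b \<Rightarrow> 'c \<Rightarrow> real"
  assumes "finite C" "\<And>f c. f \<in> F \<Longrightarrow> c \<in> C \<Longrightarrow> \<bar>u f c\<bar> \<le> b c"
  shows "finite ((\<lambda>f. \<lambda>c\<in>C. \<lfloor>u f c\<rfloor>) ` F)"
proof (rule finite_subset)
  show "(\<lambda>f. \<lambda>c\<in>C. \<lfloor>u f c\<rfloor>) ` F \<subseteq> (\<Pi>\<^sub>E c\<in>C. {\<lfloor>- b c\<rfloor>..\<lfloor>b c\<rfloor>})"
  proof (clarsimp simp: PiE_iff)
    fix f c assume "f \<in> F" "c \<in> C"
    then have "- b c \<le> u f c" "u f c \<le> b c" using assms(2)[of f c] by auto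
    then show "\<lfloor>- b c\<rfloor> \<le> \<lfloor>u f c\<rfloor> \<and> \<lfloor>u f c\<rfloor> \<le> \<lfloor>b c\<rfloor>" by (simp only: floor_mono)
  qed
qed (use assms(1) in \<open>auto intro: finite_PiE\<close>)

lemma (in geometric_data_set) finite_translation_net:
  assumes "F \<subseteq> FX" "\<epsilon> > 0"
  obtains N where "finite N" "N \<subseteq> F"
    "F \<subseteq> open_nbhd (comp_family X real_translations N) \<epsilon> (ky_fan \<mu>)"
proof -
  interpret M: Metric_space X "data_dist X FX" by (rule metric)
  interpret P: prob_space \<mu> by (rule prob)
  \<comment> \<open>Three errors of size \<open>r\<close> will add up to \<epsilon>/2, which leaves
    the strict inequality required by \<open>open_nbhd\<close>.\<close>
  define r where "r = \<epsilon> / 6"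
  have "r > 0" "3 * r > 0" "3 * r < \<epsilon>" using assms(2) by (auto simp: r_def)
  obtain C where C: "finite C" "C \<subseteq> X" "(\<Union>c\<in>C. M.mball c r) \<in> sets \<mu>"
    "measure \<mu> (X - (\<Union>c\<in>C. M.mball c r)) < 3 * r"
    using finite_ball_cover[OF \<open>r > 0\<close> \<open>3 * r > 0\<close>] .
  obtain x0 where x0: "x0 \<in> X" using P.not_empty space_eq by auto
  \<comment> \<open>Scaling by \<open>r\<close> turns rounding to multiples of \<open>r\<close> into
    \<open>floor\<close>.\<close>
  define u where "u f c = (f c - f x0) / r" for f c
  define \<Phi> where "\<Phi> f = (\<lambda>c\<in>C. \<lfloor>u f c\<rfloor>)" for f
  have "\<bar>u f c\<bar> \<le> data_dist X FX c x0 / r" if "f \<in> F" "c \<in> C" for f c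
    using abs_feature_diff_le[of f c x0] that assms(1) C(2) x0 \<open>r > 0\<close>
    by (auto simp: u_def intro!: divide_right_mono)
  then have "finite (\<Phi> ` F)"
    unfolding \<Phi>_def by (rule finite_floor_patterns[OF C(1)])
  \<comment> \<open>One feature is chosen from \<open>F\<close> for each pattern.\<close>
  then obtain N where N: "N \<subseteq> F" "finite N" "\<Phi> ` F = \<Phi> ` N"
    by (metis finite_subset_image subset_refl)
  show thesis
  proof (rule that[OF N(2,1)], rule subsetI)
    fix f assume "f \<in> F"
    then obtain g where g: "g \<in> N" "\<Phi> f = \<Phi> g" using N(3) by (metis image_iff)
    have features: "f \<in> FX" "g \<in> FX" using \<open>f \<in> F\<close> g(1) N(1) assms(1) by auto
    \<comment> \<open>This translation makes \<open>p (g x0) = f x0\<close>, which undoes the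
      normalisation at the base point.\<close>
    define p where "p t = t + (f x0 - g x0)" for t
    have centre: "\<bar>p (g c) - f c\<bar> \<le> r" if "c \<in> C" for c
    proof -
      have "\<lfloor>u f c\<rfloor> = \<lfloor>u g c\<rfloor>" using fun_cong[OF g(2), of c] that by (simp add: \<Phi>_def)
      then have "\<bar>u g c - u f c\<bar> \<le> 1" by linarith
      moreover have "u g c - u f c = (p (g c) - f c) / r"
        by (simp add: u_def p_def diff_divide_distrib[symmetric])
      ultimately show ?thesis using \<open>r > 0\<close> by simp
    qed
    have "ky_fan \<mu> (compose X p g) f \<le> 3 * r"
    proof (rule ky_fan_le[OF P.finite_measure_axioms C(3)])
      show "measure \<mu> (space \<mu> - (\<Union>c\<in>C. M.mball c r)) \<le> 3 * r"
        using C(4) space_eq by simp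
      fix x assume "x \<in> (\<Union>c\<in>C. M.mball c r)"
      then obtain c where c: "c \<in> C" "x \<in> X" "c \<in> X" "data_dist X FX c x < r" by auto
      have "\<bar>g c - g x\<bar> \<le> r" "\<bar>f c - f x\<bar> \<le> r"
        using abs_feature_diff_le[OF _ c(3,2)] features c(4) by (meson less_imp_le order_trans)+
      \<comment> \<open>Triangle inequality through the centre: from \<open>x\<close> to
        \<open>c\<close> along \<open>g\<close>, from \<open>g\<close> to \<open>f\<close> at
        \<open>c\<close>, and back to \<open>x\<close> along \<open>f\<close>.\<close>
      then show "\<bar>compose X p g x - f x\<bar> \<le> 3 * r"
        using centre[OF c(1)] c(2) by (simp add: compose_eq p_def)
    qed
    moreover have "compose X p g \<in> comp_family X real_translations N"
      unfolding comp_family_def real_translations_def p_def using g(1) by blast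
    ultimately show "f \<in> open_nbhd (comp_family X real_translations N) \<epsilon> (ky_fan \<mu>)"
      unfolding open_nbhd_def using \<open>3 * r < \<epsilon>\<close> by force
  qed
qed

theorem theorem3p19:
  fixes X :: "'a set" and FX F :: "('a \<Rightarrow> real) set" and \<mu> :: "'a measure"
    and L :: "(real \<Rightarrow> real) set"
  assumes "monoidal L" and "real_translations \<subseteq> L"
    and "geometric_data_set X FX \<mu>"
    and "F \<subseteq> FX" and "L_closed X L F"
  shows "L_compact X \<mu> L F"
  unfolding L_compact_def
proof (intro conjI allI impI)
  show "L_closed X L F" by fact
  fix \<epsilon> :: real assume "\<epsilon> > 0"
  interpret geometric_data_set X FX \<mu> by fact
  obtain N where N: "finite N" "N \<subseteq> F"
    "F \<subseteq> open_nbhd (comp_family X real_translations N) \<epsilon> (ky_fan \<mu>)"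
    using finite_translation_net[OF assms(4) \<open>\<epsilon> > 0\<close>] .
  have "comp_family X real_translations N \<subseteq> comp_family X L N"
    using assms(2) unfolding comp_family_def by blast
  then have "F \<subseteq> open_nbhd (comp_family X L N) \<epsilon> (ky_fan \<mu>)"
    using N(3) unfolding open_nbhd_def by blast
  \<comment> \<open>A single admissible net bounds the infimum by a finite value.\<close>
  then have "covering_number X \<mu> L F \<epsilon> \<le> enat (card N)"
    unfolding covering_number_def using N(1,2) by (intro Inf_lower) blast
  then show "covering_number X \<mu> L F \<epsilon> < \<infinity>"
    using enat_ord_simps(4) le_less_trans by blast
qed

end
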